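(* Let the sequence $\{X_i\}_{i=0}^\infty$ be generated by the SCF iteration (described in the context). The following statements hold. (a) The sequence $\{f_\theta(X_i)\}$ is monotonically increasing (in the sense of non-decreasing) and convergent. (b) If $\mathrm{trace}(\widehat X_i^{T}E(X_{i-1})\widehat X_i)>\mathrm{trace}(X_{i-1}^{T}E(X_{i-1})X_{i-1})$, then $f_\theta(X_{i-1})<f_\theta(X_i)$. (c) $\{X_i\}_{i=0}^\infty$ has a convergent subsequence $\{X_i\}_{i\in\mathcal{I}}$, where $\mathcal{I}$ is a subset of $\{0,1,2,\ldots\}$, and $\lim_{i\to\infty,\,i\in\mathcal{I}}f_\theta(X_i)=\lim_{i\to\infty}f_\theta(X_i)$; i.e., along any convergent subsequence, the limit of the objective value is the same. (d) Let $\{X_i\}_{i\in\mathcal{I}}$ be any convergent subsequence of $\{X_i\}_{i=0}^\infty$ with an accumulation point $X_*$ satisfying $\zeta=\lambda_k(E(X_* ))-\lambda_{k+1}(E(X_* ))>0$. Then $X_*$ satisfies the first order optimality condition $$\frac{2}{[\mathrm{trace}(X_*^{T}BX_* )]^{\theta}}\Big[AX_*+\frac D2-\theta f_1(X_* )BX_*\Big]=X_*\widehat\Lambda,\quad X_*\in\mathbb{O}^{n\times k},\ \widehat\Lambda^{T}=\widehat\Lambda\in\mathbb{R}^{k\times k},$$ for some $\widehat\Lambda$, and the necessary condition for a local/global maximizer of $f_\theta$ over $\mathbb{O}^{n\times k}$: $X_*^{T}D\succeq0$ and $X_*$ is an orthonormal basis matrix of the invariant subspace associated with the $k$ largest eigenvalues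 of $E(X_* )$.
   Context: Standing setting: $1\le k<n$; $A,B\in\mathbb{R}^{n\times n}$ are symmetric, $B$ is positive semidefinite with $\mathrm{rank}(B)>n-k$; $D\in\mathbb{R}^{n\times k}$; $0\le\theta\le 1$; $\mathbb{O}^{p\times q}=\{X\in\mathbb{R}^{p\times q}: X^{T}X=I_q\}$. It is assumed that there exists $X\in\mathbb{O}^{n\times k}$ with $\mathrm{trace}(X^{T}AX+X^{T}D)\ge0$. For $X\in\mathbb{O}^{n\times k}$, $$f_\theta(X)=\frac{\mathrm{trace}(X^{T}AX+X^{T}D)}{[\mathrm{trace}(X^{T}BX)]^{\theta}},\quad f_1(X)=\frac{\mathrm{trace}(X^{T}AX+X^{T}D)}{\mathrm{trace}(X^{T}BX)},$$ $$E(X)=\frac{2}{[\mathrm{trace}(X^{T}BX)]^{\theta}}\Big[A+\frac{DX^{T}+XD^{T}}{2}-\theta f_1(X)B\Big].$$ $\lambda_1(M)\ge\lambda_2(M)\ge\cdots$ are the eigenvalues of a symmetric $M$, with multiplicity. $M\succeq0$ means symmetric positive semidefinite. SCF iteration: start from $X_0\in\mathbb{O}^{n\times k}$, with $\mathrm{trace}(X_0^{T}AX_0+X_0^{T}D)\ge0$ if $0<\theta<1$ (no such requirement if $\theta\in\{0,1\}$). For $i=1,2,\ldots$: set $E_i=E(X_{i-1})$; compute $\widehat X_i\in\mathbb{O}^{n\times k}$ either as an orthonormal matrix of eigenvectors of $E_i$ associated with its $k$ largest eigenvalues, or simply as some $\widehat X_i\in\mathbb{O}^{n\times k}$ with $\mathrm{trace}(\widehat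 X_i^{T}E_i\widehat X_i)>\mathrm{trace}(X_{i-1}^{T}E_iX_{i-1})$; compute an SVD $\widehat X_i^{T}D=U_i\Sigma_iV_i^{T}$ (with $U_i,V_i\in\mathbb{O}^{k\times k}$); set $X_i=\widehat X_iU_iV_i^{T}$. The iteration is run without termination.
   Formalization: In (d), the first order condition and the invariant-subspace claim assume that infinitely many steps leaving the subsequence compute X̂ from eigenvectors of the k largest eigenvalues; with only the strict trace increase they can fail. *)

theory Defs
  imports
    "HOL-Analysis.Analysis"
    "HOL-Computational_Algebra.Polynomial"
    "HOL-Library.Multiset"
begin

text \<open>An \<open>n \<times> k\<close> real matrix has type \<open>real^'k^'n\<close>, with \<open>n = CARD('n)\<close> and
  \<open>k = CARD('k)\<close>; both are at least 1 because types are nonempty.\<close>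

definition stiefel :: "(real^'q^'p) set" where
  "stiefel = {X. transpose X ** X = mat 1}"

definition symmetric_matrix :: "real^'p^'p \<Rightarrow> bool" where
  "symmetric_matrix M \<longleftrightarrow> transpose M = M"

definition pos_semidef :: "real^'p^'p \<Rightarrow> bool" where
  "pos_semidef M \<longleftrightarrow> symmetric_matrix M \<and> (\<forall>x. 0 \<le> x \<bullet> (M *v x))"

definition charpoly :: "real^'p^'p \<Rightarrow> real poly" where
  "charpoly M = det (mat [:0, 1:] - map_matrix (\<lambda>c. [:c:]) M)"

text \<open>\<open>eigval M j\<close> is the \<open>j\<close>-th largest eigenvalue of \<open>M\<close>, counted with multiplicity from
  \<open>j = 1\<close>. It is meant for symmetric \<open>M\<close> (where all roots of the characteristic polynomial
  are real) and \<open>1 \<le> j \<le> CARD('p)\<close>.\<close>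
definition eigval :: "real^'p^'p \<Rightarrow> nat \<Rightarrow> real" where
  "eigval M j = rev (sorted_list_of_multiset (proots (charpoly M))) ! (j - 1)"

text \<open>The column index type \<open>'q\<close> carries no order, so the columns are matched with the
  \<open>CARD('q)\<close> largest eigenvalues by an arbitrary bijection.\<close>
definition top_eigvecs :: "real^'p^'p \<Rightarrow> real^'q^'p \<Rightarrow> bool" where
  "top_eigvecs M X \<longleftrightarrow> X \<in> stiefel \<and>
     (\<exists>\<sigma>. bij_betw \<sigma> (UNIV :: 'q set) {1..CARD('q)} \<and>
          (\<forall>j. M *v column j X = eigval M (\<sigma> j) *s column j X))"

text \<open>Orthonormal basis matrices of the invariant subspace associated with the \<open>CARD('q)\<close> largest
  eigenvalues: here the columns of \<open>X\<close> need not themselves be eigenvectors.\<close>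
definition top_invariant_basis :: "real^'p^'p \<Rightarrow> real^'q^'p \<Rightarrow> bool" where
  "top_invariant_basis M X \<longleftrightarrow> X \<in> stiefel \<and>
     (\<exists>Y :: real^'q^'p. top_eigvecs M Y \<and> span (columns X) = span (columns Y))"

text \<open>As \<open>'q\<close> is unordered, the singular values are not required to be sorted;
  a simultaneous column permutation of \<open>U\<close> and \<open>V\<close> sorts them and leaves
  \<open>U ** transpose V\<close> unchanged.\<close>
definition is_svd :: "real^'q^'q \<Rightarrow> real^'q^'q \<Rightarrow> real^'q^'q \<Rightarrow> real^'q^'q \<Rightarrow> bool" where
  "is_svd M U S V \<longleftrightarrow> orthogonal_matrix U \<and> orthogonal_matrix V \<and>
     (\<forall>i j. i \<noteq> j \<longrightarrow> S $ i $ j = 0) \<and> (\<forall>i. 0 \<le> S $ i $ i) \<and>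
     M = U ** S ** transpose V"

definition numer :: "real^'n^'n \<Rightarrow> real^'k^'n \<Rightarrow> real^'k^'n \<Rightarrow> real" where
  "numer A D X = trace (transpose X ** A ** X + transpose X ** D)"

definition denom :: "real^'n^'n \<Rightarrow> real^'k^'n \<Rightarrow> real" where
  "denom B X = trace (transpose X ** B ** X)"

definition f_obj ::
  "real^'n^'n \<Rightarrow> real^'n^'n \<Rightarrow> real^'k^'n \<Rightarrow> real \<Rightarrow> real^'k^'n \<Rightarrow> real" where
  "f_obj A B D \<theta> X = numer A D X / (denom B X powr \<theta>)"

definition f_one :: "real^'n^'n \<Rightarrow> real^'n^'n \<Rightarrow> real^'k^'n \<Rightarrow> real^'k^'n \<Rightarrow> real" where
  "f_one A B D X = numer A D X / denom B X"

definition E_mat ::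
  "real^'n^'n \<Rightarrow> real^'n^'n \<Rightarrow> real^'k^'n \<Rightarrow> real \<Rightarrow> real^'k^'n \<Rightarrow> real^'n^'n" where
  "E_mat A B D \<theta> X =
     (2 / (denom B X powr \<theta>)) *\<^sub>R
       (A + (1 / 2) *\<^sub>R (D ** transpose X + X ** transpose D) - (\<theta> * f_one A B D X) *\<^sub>R B)"

text \<open>\<open>Xh i\<close> is the intermediate matrix of step \<open>i \<ge> 1\<close>; \<open>Xh 0\<close> is irrelevant. Each step may
  choose independently between the two ways of computing it.\<close>
definition scf_iteration ::
  "real^'n^'n \<Rightarrow> real^'n^'n \<Rightarrow> real^'k^'n \<Rightarrow> real \<Rightarrow>
   (nat \<Rightarrow> real^'k^'n) \<Rightarrow> (nat \<Rightarrow> real^'k^'n) \<Rightarrow> bool" where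
  "scf_iteration A B D \<theta> X Xh \<longleftrightarrow>
     X 0 \<in> stiefel \<and>
     (0 < \<theta> \<and> \<theta> < 1 \<longrightarrow> 0 \<le> numer A D (X 0)) \<and>
     (\<forall>i\<ge>1.
        Xh i \<in> stiefel \<and>
        (top_eigvecs (E_mat A B D \<theta> (X (i - 1))) (Xh i) \<or>
         trace (transpose (Xh i) ** E_mat A B D \<theta> (X (i - 1)) ** Xh i)
           > trace (transpose (X (i - 1)) ** E_mat A B D \<theta> (X (i - 1)) ** X (i - 1))) \<and>
        (\<exists>U S V. is_svd (transpose (Xh i) ** D) U S V \<and> X i = Xh i ** U ** transpose V))"

end

theory Submission
  imports Defs
begin

text \<open>
  Each step of the iteration maximises, or at least increases, the quadratic surrogate
  \<open>Y \<mapsto> trace (Y\<^sup>T E(X) Y)\<close> and then aligns the result with \<open>D\<close> through a polar factor. The key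
  estimate \<open>scf_step_ascent\<close> says that the objective grows by at least a positive multiple of the
  growth of the surrogate. Two inequalities are behind it: the trace of \<open>Y\<^sup>T D G\<close> over contractions
  \<open>G\<close> is largest at the transposed polar factor (\<open>trace_svd_mult_stiefel_le\<close>), which replaces the
  linear term of the surrogate by the one of the objective, and \<open>t powr \<theta> \<le> 1 + \<theta> (t - 1)\<close>,
  which replaces the linearised denominator by the actual one. The hypothesis on the rank of \<open>B\<close> keeps the denominator
  positive (\<open>denom_pos\<close>).

  Monotonicity and the strict increase are then immediate, since by \<open>ky_fan_inequality\<close> a matrix of
  top eigenvectors never decreases the surrogate. The matrices with orthonormal columns form a
  compact set, on which the objective is continuous; so some subsequence converges, and a monotone
  sequence with a convergent subsequence converges to the same limit.

  At a limit point \<open>X\<^sub>*\<close> reached through infinitely many eigenvector steps, the increments of the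
  objective tend to 0, and so does, along these steps, the distance of \<open>trace (X\<^sub>i\<^sup>T E(X\<^sub>i) X\<^sub>i)\<close> from its
  maximal possible value. By continuity \<open>X\<^sub>*\<close> maximises \<open>trace (Y\<^sup>T E(X\<^sub>*) Y)\<close>. With a gap after the
  \<open>k\<close>-th eigenvalue, \<open>ky_fan_equality\<close> shows that \<open>X\<^sub>*\<close> is an orthogonal rotation of a matrix of top
  eigenvectors, which gives the invariant subspace and, by \<open>first_order_condition\<close>, the first
  order condition. Positive semidefiniteness of \<open>X\<^sub>*\<^sup>T D\<close> is inherited from the aligned iterates.

  Both Ky Fan results rest on \<open>spectral_decomposition\<close> and on \<open>eigval_enumeration\<close>, which identifies
  the sorted roots of the characteristic polynomial with the sorted diagonal of an orthogonal
  diagonalisation.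
\<close>

section \<open>Matrices with orthonormal columns\<close>

definition diag_matrix :: "('p \<Rightarrow> 'a::zero) \<Rightarrow> 'a^'p^'p" where
  "diag_matrix d = (\<chi> i j. if i = j then d i else 0)"

lemma diag_matrix_nth [simp]: "diag_matrix d $ i $ j = (if i = j then d i else 0)"
  by (simp add: diag_matrix_def)

lemma transpose_diag_matrix [simp]: "transpose (diag_matrix d) = diag_matrix d"
  by (simp add: vec_eq_iff transpose_def)

lemma stiefel_iff_orthonormal_columns:
  "X \<in> stiefel \<longleftrightarrow> (\<forall>i j. column i X \<bullet> column j X = (if i = j then 1 else 0))"
  by (auto simp: stiefel_def matrix_mult_transpose_dot_column vec_eq_iff mat_def)

lemma norm_column_stiefel: "X \<in> stiefel \<Longrightarrow> norm (column j X) = 1"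
  by (simp add: stiefel_iff_orthonormal_columns norm_eq_1)

lemma stiefel_square_iff: "X \<in> stiefel \<longleftrightarrow> orthogonal_matrix X" for X :: "real^'p^'p"
  by (simp add: stiefel_def orthogonal_matrix)

lemma stiefel_mult:
  assumes "X \<in> stiefel" "Q \<in> stiefel"
  shows "X ** Q \<in> stiefel"
proof -
  have "transpose (X ** Q) ** (X ** Q) = transpose Q ** (transpose X ** X) ** Q"
    by (simp add: matrix_transpose_mul matrix_mul_assoc)
  with assms show ?thesis
    by (simp add: stiefel_def)
qed

lemma inner_matrix_vector: "(M *v x) \<bullet> y = x \<bullet> (transpose M *v y)" for M :: "real^'q^'p"
  using dot_lmul_matrix[of y M x] by (simp add: inner_commute)

lemma stiefel_preserves_inner:
  assumes "X \<in> stiefel"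
  shows "(X *v x) \<bullet> (X *v y) = x \<bullet> y"
  using assms by (simp add: inner_matrix_vector matrix_vector_mul_assoc stiefel_def)

text \<open>Bessel's inequality. If \<open>r\<close> is row \<open>i\<close> of \<open>W\<close>, then \<open>r \<bullet> r\<close> is entry \<open>i\<close> of \<open>W *v r\<close>,
  a vector of the same norm as \<open>r\<close>; hence \<open>(r \<bullet> r)\<^sup>2 \<le> r \<bullet> r\<close>.\<close>

lemma bessel_row_stiefel:
  fixes W :: "real^'q^'p"
  assumes "W \<in> stiefel"
  shows "(W $ i) \<bullet> (W $ i) \<le> 1"
proof -
  define r where "r = W $ i"
  have "(r \<bullet> r)^2 = ((W *v r) $ i)^2"
    by (simp add: r_def matrix_vector_mul_component)
  also have "\<dots> \<le> (norm (W *v r))^2"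
    by (metis component_le_norm_cart abs_ge_zero power2_abs power_mono)
  also have "\<dots> = r \<bullet> r"
    using stiefel_preserves_inner[OF assms, of r r] by (simp add: power2_norm_eq_inner)
  finally have "(r \<bullet> r) * (r \<bullet> r) \<le> r \<bullet> r"
    by (simp add: power2_eq_square)
  then have "\<not> 1 < r \<bullet> r"
    using mult_strict_left_mono[of 1 "r \<bullet> r" "r \<bullet> r"] by linarith
  then show ?thesis
    by (simp add: r_def)
qed

lemma trace_quadratic_columns:
  "trace (transpose Y ** M ** Y) = (\<Sum>j\<in>UNIV. column j Y \<bullet> (M *v column j Y))"
  for Y :: "real^'q^'p"
  unfolding matrix_mul_assoc[symmetric]
  by (simp add: trace_def matrix_matrix_mult_def transpose_def column_def inner_vec_def
      matrix_vector_mult_def)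

lemma trace_transpose: "trace (transpose M) = trace M"
  by (simp add: trace_def transpose_def)

lemma compact_stiefel: "compact (stiefel :: (real^'q^'p) set)"
proof -
  have "closed (stiefel :: (real^'q^'p) set)"
  proof (unfold closed_sequential_limits, intro allI impI, elim conjE)
    fix Z :: "nat \<Rightarrow> real^'q^'p" and L
    assume Z: "\<forall>n. Z n \<in> stiefel" and lim: "Z \<longlonglongrightarrow> L"
    have "(\<lambda>n. column i (Z n) \<bullet> column j (Z n)) \<longlonglongrightarrow> column i L \<bullet> column j L" for i j
      unfolding column_def
      by (intro tendsto_inner tendsto_vec_lambda tendsto_vec_nth lim)
    moreover have "column i (Z n) \<bullet> column j (Z n) = (if i = j then 1 else 0)" for n i j
      using Z by (simp add: stiefel_iff_orthonormal_columns)
    ultimately have "column i L \<bullet> column j L = (if i = j then 1 else 0)" for i j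
      by (simp add: LIMSEQ_const_iff)
    then show "L \<in> stiefel"
      by (simp add: stiefel_iff_orthonormal_columns)
  qed
  moreover have "bounded (stiefel :: (real^'q^'p) set)"
  proof (rule boundedI)
    fix X :: "real^'q^'p"
    assume "X \<in> stiefel"
    have "norm X \<le> (\<Sum>i\<in>UNIV. norm (X $ i))"
      by (simp add: norm_vec_def L2_set_le_sum)
    also have "\<dots> \<le> (\<Sum>i\<in>(UNIV::'p set). 1)"
      using bessel_row_stiefel[OF \<open>X \<in> stiefel\<close>] by (intro sum_mono) (simp add: norm_le_square)
    finally show "norm X \<le> real CARD('p)"
      by simp
  qed
  ultimately show ?thesis
    by (simp add: compact_eq_bounded_closed)
qed

section \<open>The spectral theorem for real symmetric matrices\<close>

lemma symmetric_inner:
  assumes "symmetric_matrix M"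
  shows "(M *v x) \<bullet> y = x \<bullet> (M *v y)"
  using assms by (simp add: inner_matrix_vector symmetric_matrix_def)

text \<open>A vector at which a nonnegative quadratic form vanishes minimises the form, so the derivative
  there is zero. This is used twice: for the eigenvalue equation at a maximiser of the Rayleigh
  quotient, and to see that \<open>trace (X\<^sup>T B X) = 0\<close> forces \<open>B X = 0\<close>.\<close>

lemma nonneg_form_null_vector:
  fixes N :: "real^'p^'p"
  assumes sym: "symmetric_matrix N" and S: "subspace S"
    and nonneg: "\<And>x. x \<in> S \<Longrightarrow> 0 \<le> x \<bullet> (N *v x)"
    and v: "v \<in> S" "v \<bullet> (N *v v) = 0" and y: "y \<in> S"
  shows "y \<bullet> (N *v v) = 0"
proof -
  define b c where "b = y \<bullet> (N *v v)" and "c = y \<bullet> (N *v y)"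
  have c: "0 \<le> c"
    using nonneg[OF y] by (simp add: c_def)
  have quad: "0 \<le> 2 * t * b + t^2 * c" for t
  proof -
    have "v + t *\<^sub>R y \<in> S"
      using S v y by (simp add: subspace_add subspace_scale)
    then have "0 \<le> (v + t *\<^sub>R y) \<bullet> (N *v (v + t *\<^sub>R y))"
      by (rule nonneg)
    also have "\<dots> = 2 * t * b + t^2 * c"
      using symmetric_inner[OF sym, of v y] v(2)
      by (simp add: matrix_vector_right_distrib matrix_vector_mult_scaleR inner_add_left
          inner_add_right b_def c_def power2_eq_square algebra_simps inner_commute)
    finally show ?thesis .
  qed
  \<comment> \<open>The form along the line \<open>v - t y\<close> is \<open>- 2 t b + t\<^sup>2 c\<close>; dividing by \<open>c + 1\<close> instead of
      the minimising \<open>c\<close> covers the case \<open>c = 0\<close> as well.\<close>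
  define t where "t = b / (c + 1)"
  have b: "b = t * (c + 1)"
    using c by (simp add: t_def)
  have "0 \<le> 2 * (- t) * b + (- t)^2 * c"
    by (rule quad)
  also have "\<dots> = - (t^2 * (c + 2))"
    by (simp add: b power2_eq_square algebra_simps)
  finally have "t^2 * (c + 2) \<le> 0"
    by simp
  then have "t = 0"
    using c by (simp add: mult_le_0_iff)
  with b have "b = 0"
    by simp
  then show ?thesis
    by (simp add: b_def)
qed

text \<open>A maximiser \<open>v\<close> of \<open>x \<bullet> (M *v x)\<close> on the unit sphere of the subspace is an eigenvector: with
  \<open>c\<close> the maximum, the form of \<open>c I - M\<close> is nonnegative on the subspace and vanishes at \<open>v\<close>, so
  \<open>c v - M v\<close> is orthogonal to the subspace, in which it lies.\<close>

lemma exists_eigenvector_in_invariant_subspace: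
  fixes M :: "real^'p^'p"
  assumes sym: "symmetric_matrix M" and S: "subspace S" "S \<noteq> {0}"
    and inv: "\<And>x. x \<in> S \<Longrightarrow> M *v x \<in> S"
  obtains v c where "v \<in> S" "norm v = 1" "M *v v = c *\<^sub>R v"
proof -
  define K where "K = S \<inter> sphere 0 1"
  have "compact K"
    unfolding K_def using closed_subspace[OF S(1)] by (intro closed_Int_compact) auto
  moreover have "K \<noteq> {}"
  proof -
    obtain x where x: "x \<in> S" "x \<noteq> 0"
      using S subspace_0 by blast
    then have "x /\<^sub>R norm x \<in> K"
      using S(1) by (simp add: K_def subspace_scale)
    then show ?thesis
      by blast
  qed
  moreover have "continuous_on K (\<lambda>x. x \<bullet> (M *v x))"
    by (intro continuous_intros matrix_vector_mult_linear_continuous_on)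
  ultimately obtain v where v: "v \<in> K" and max: "\<And>x. x \<in> K \<Longrightarrow> x \<bullet> (M *v x) \<le> v \<bullet> (M *v v)"
    using continuous_attains_sup[of K "\<lambda>x. x \<bullet> (M *v x)"] by auto
  define c where "c = v \<bullet> (M *v v)"
  define N where "N = c *\<^sub>R mat 1 - M"
  have Nv: "N *v x = c *\<^sub>R x - M *v x" for x
    by (simp add: N_def matrix_vector_mult_diff_rdistrib scaleR_matrix_vector_assoc[symmetric])
  have symN: "symmetric_matrix N"
    using sym by (auto simp: N_def symmetric_matrix_def transpose_def vec_eq_iff mat_def)
  have nonneg: "0 \<le> x \<bullet> (N *v x)" if "x \<in> S" for x
  proof (cases "x = 0")
    case False
    define u where "u = x /\<^sub>R norm x"
    have x: "x = norm x *\<^sub>R u"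
      using False by (simp add: u_def)
    have "u \<in> K"
      using False that S(1) by (simp add: K_def u_def subspace_scale)
    then have "u \<bullet> (M *v u) \<le> c" "u \<bullet> u = 1"
      using max by (auto simp: c_def K_def norm_eq_1)
    then have "0 \<le> u \<bullet> (N *v u)"
      by (simp add: Nv inner_diff_right)
    moreover have "x \<bullet> (N *v x) = (norm x)^2 * (u \<bullet> (N *v u))"
      using arg_cong[OF x, of "\<lambda>z. z \<bullet> (N *v z)"]
      by (simp add: matrix_vector_mult_scaleR power2_eq_square mult.assoc)
    ultimately show ?thesis
      by simp
  qed simp
  have vS: "v \<in> S" "norm v = 1"
    using v by (auto simp: K_def)
  have "v \<bullet> (N *v v) = 0"
    using vS by (simp add: Nv inner_diff_right c_def norm_eq_1)
  moreover have NvS: "N *v v \<in> S"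
    using S(1) inv vS by (simp add: Nv subspace_diff subspace_scale)
  ultimately have "(N *v v) \<bullet> (N *v v) = 0"
    using nonneg_form_null_vector[OF symN S(1) nonneg vS(1) _ NvS] by blast
  then have "M *v v = c *\<^sub>R v"
    by (simp add: Nv)
  with vS show ?thesis
    using that by blast
qed

text \<open>An orthonormal set of eigenvectors of maximal cardinality must be a basis: otherwise its
  orthogonal complement is a nonzero subspace, invariant because \<open>M\<close> is symmetric, and contains a
  further unit eigenvector.\<close>

theorem spectral_decomposition:
  fixes M :: "real^'p^'p"
  assumes sym: "symmetric_matrix M"
  obtains P d where "orthogonal_matrix P" "M = P ** diag_matrix d ** transpose P"
proof -
  define good where "good V \<longleftrightarrow> pairwise orthogonal V \<and> (\<forall>v\<in>V. norm v = 1 \<and> (\<exists>c. M *v v = c *\<^sub>R v))"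
    for V
  have indep: "independent V" if "good V" for V
    using that by (intro pairwise_orthogonal_independent) (auto simp: good_def)
  have card_le: "finite V \<and> card V \<le> CARD('p)" if "good V" for V
    using independent_bound[OF indep[OF that]] by simp
  have "good {}"
    by (simp add: good_def)
  then obtain V where V: "good V" and maxV: "\<And>W. good W \<Longrightarrow> card W \<le> card V"
    using ex_has_greatest_nat[of good "{}" card "Suc CARD('p)"] card_le
    by (auto simp: less_Suc_eq_le)
  have eig: "\<exists>c. M *v v = c *\<^sub>R v" if "v \<in> V" for v
    using V that by (auto simp: good_def)
  have "card V = CARD('p)"
  proof (rule ccontr)
    assume "card V \<noteq> CARD('p)"
    then have "card V < CARD('p)"
      using card_le[OF V] by linarith
    moreover have "dim V = card V"
      using indep[OF V] by (rule dim_eq_card_independent)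
    ultimately have "dim (span V) < DIM(real^'p)"
      by simp
    then obtain x where x: "x \<noteq> 0" "\<And>y. y \<in> span V \<Longrightarrow> orthogonal x y"
      using orthogonal_to_subspace_exists[of V] by (metis dim_span)
    define S where "S = {y. \<forall>v\<in>V. v \<bullet> y = 0}"
    have S: "subspace S"
      by (auto simp: S_def subspace_def inner_add_right)
    have "x \<in> S"
      using x(2) by (auto simp: S_def orthogonal_def inner_commute span_base)
    with x(1) have "S \<noteq> {0}"
      by blast
    have inv: "M *v y \<in> S" if "y \<in> S" for y
    proof -
      have "v \<bullet> (M *v y) = 0" if vV: "v \<in> V" for v
      proof -
        obtain c where "M *v v = c *\<^sub>R v"
          using eig[OF vV] by blast
        then have "v \<bullet> (M *v y) = c * (v \<bullet> y)"
          using symmetric_inner[OF sym, of v y] by simp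
        then show ?thesis
          using \<open>y \<in> S\<close> that by (simp add: S_def)
      qed
      then show ?thesis
        by (simp add: S_def)
    qed
    obtain w c where w: "w \<in> S" "norm w = 1" "M *v w = c *\<^sub>R w"
      using exists_eigenvector_in_invariant_subspace[OF sym S \<open>S \<noteq> {0}\<close> inv] by blast
    have "w \<notin> V"
      using w by (auto simp: S_def)
    moreover have "good (insert w V)"
      using V w by (auto simp: good_def pairwise_insert S_def orthogonal_def inner_commute)
    ultimately show False
      using maxV[of "insert w V"] card_le[OF V] by simp
  qed
  then obtain e where e: "bij_betw e (UNIV :: 'p set) V"
    using card_le[OF V] finite_same_card_bij[of "UNIV :: 'p set" V] by auto
  define P where "P = (\<chi> i j. e j $ i)"
  define d where "d j = (SOME c. M *v e j = c *\<^sub>R e j)" for j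
  have colP: "column j P = e j" for j
    by (simp add: P_def column_def)
  have eV: "e j \<in> V" for j
    using e by (auto simp: bij_betw_def)
  have eM: "M *v e j = d j *\<^sub>R e j" for j
    unfolding d_def by (rule someI_ex) (use eig eV in blast)
  have "orthogonal_matrix P"
    unfolding orthogonal_matrix_orthonormal_columns colP
    using V e eV by (auto simp: good_def pairwise_def bij_betw_def inj_eq)
  moreover have "M ** P = P ** diag_matrix d"
  proof -
    have "(M ** P) $ i $ j = (P ** diag_matrix d) $ i $ j" for i j
    proof -
      have "(M ** P) $ i $ j = (M *v e j) $ i"
        by (simp add: matrix_matrix_mult_def matrix_vector_mult_def P_def)
      also have "\<dots> = (P ** diag_matrix d) $ i $ j"
        unfolding eM
        by (simp add: matrix_matrix_mult_def P_def if_distrib[of "\<lambda>x. _ * x"] cong: if_cong)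
      finally show ?thesis .
    qed
    then show ?thesis
      by (simp add: vec_eq_iff)
  qed
  ultimately have "M = P ** diag_matrix d ** transpose P"
    by (metis matrix_mul_assoc matrix_mul_rid orthogonal_matrix_def)
  with \<open>orthogonal_matrix P\<close> show ?thesis
    using that by blast
qed

section \<open>Eigenvalues as sorted diagonal entries\<close>

lemma const_poly_sum: "[:sum f S:] = (\<Sum>i\<in>S. [:f i:])"
  by (auto simp: poly_eq_iff coeff_sum coeff_pCons split: nat.split)

lemma map_matrix_const_poly_mult:
  "map_matrix (\<lambda>c. [:c:]) (M ** N) = map_matrix (\<lambda>c. [:c:]) M ** map_matrix (\<lambda>c. [:c:]) N"
  for M :: "real^'q^'p"
  by (simp add: vec_eq_iff matrix_matrix_mult_def const_poly_sum mult.commute)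

lemma matrix_diff_ldistrib: "M ** (N - L) = M ** N - M ** L" for M :: "'a::comm_ring_1^'q^'p"
  by (simp add: vec_eq_iff matrix_matrix_mult_def right_diff_distrib sum_subtractf)

lemma matrix_diff_rdistrib: "(N - L) ** M = N ** M - L ** M" for M :: "'a::comm_ring_1^'q^'p"
  by (simp add: vec_eq_iff matrix_matrix_mult_def left_diff_distrib sum_subtractf)

lemma matrix_add_rdistrib: "(N + L) ** M = N ** M + L ** M" for M :: "'a::comm_ring_1^'q^'p"
  by (simp add: vec_eq_iff matrix_matrix_mult_def distrib_right sum.distrib)

lemma mat_commute: "mat c ** M = M ** mat c" for M :: "'a::comm_ring_1^'p^'p"
  by (simp add: vec_eq_iff matrix_matrix_mult_def mat_def if_distrib[of "\<lambda>x. _ * x"]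
      if_distrib[of "\<lambda>x. x * _"] mult.commute cong: if_cong)

text \<open>Conjugating by the constant polynomial matrix of \<open>P\<close> turns the characteristic matrix into a
  diagonal one without changing its determinant.\<close>

lemma charpoly_spectral:
  fixes P :: "real^'p^'p"
  assumes P: "orthogonal_matrix P"
  shows "charpoly (P ** diag_matrix d ** transpose P) = (\<Prod>i\<in>UNIV. [:- d i, 1:])"
proof -
  let ?c = "map_matrix (\<lambda>c::real. [:c:])"
  have inverse: "?c P ** ?c (transpose P) = mat 1"
    using P unfolding map_matrix_const_poly_mult[symmetric] orthogonal_matrix_def
    by (simp add: vec_eq_iff mat_def)
  have "?c P ** mat [:0, 1:] ** ?c (transpose P) = mat [:0, 1:] ** (?c P ** ?c (transpose P))"
    by (simp only: mat_commute[of "[:0, 1:]" "?c P"] matrix_mul_assoc)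
  then have "mat [:0, 1:] = ?c P ** mat [:0, 1:] ** ?c (transpose P)"
    by (simp add: inverse)
  then have "mat [:0, 1:] - ?c (P ** diag_matrix d ** transpose P)
      = ?c P ** (mat [:0, 1:] - ?c (diag_matrix d)) ** ?c (transpose P)"
    by (simp add: map_matrix_const_poly_mult matrix_diff_ldistrib matrix_diff_rdistrib)
  moreover have "det (?c P) * det (?c (transpose P)) = 1"
    unfolding det_mul[symmetric] inverse by simp
  ultimately have "charpoly (P ** diag_matrix d ** transpose P)
      = det (mat [:0, 1:] - ?c (diag_matrix d))"
    by (simp add: charpoly_def det_mul mult.commute mult.left_commute)
  also have "\<dots> = (\<Prod>i\<in>UNIV. (mat [:0, 1:] - ?c (diag_matrix d)) $ i $ i)"
    by (intro det_diagonal) (simp add: mat_def)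
  finally show ?thesis
    by (simp add: mat_def)
qed

text \<open>This links \<open>eigval\<close>, a position in the sorted list of roots of the characteristic polynomial, to
  the diagonal of any orthogonal diagonalisation: sorting the index type by decreasing \<open>d\<close> gives
  the enumeration \<open>\<pi>\<close>.\<close>

lemma eigval_enumeration:
  fixes P :: "real^'p^'p" and d :: "'p \<Rightarrow> real"
  defines "M \<equiv> P ** diag_matrix d ** transpose P"
  assumes P: "orthogonal_matrix P"
  obtains \<pi> where "bij_betw \<pi> {1..CARD('p)} (UNIV :: 'p set)"
    and "\<And>j. j \<in> {1..CARD('p)} \<Longrightarrow> eigval M j = d (\<pi> j)"
    and "\<And>i j. 1 \<le> i \<Longrightarrow> i \<le> j \<Longrightarrow> j \<le> CARD('p) \<Longrightarrow> eigval M j \<le> eigval M i"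
proof -
  obtain us :: "'p list" where us: "set us = UNIV" "distinct us"
    using finite_distinct_list[of "UNIV :: 'p set"] by auto
  define xs where "xs = sort_key (\<lambda>i. - d i) us"
  have xs: "set xs = UNIV" "distinct xs"
    using us by (simp_all add: xs_def)
  then have len: "length xs = CARD('p)"
    by (metis distinct_card)
  have "sorted (map (\<lambda>i. - d i) xs)"
    by (simp add: xs_def)
  then have desc: "sorted (rev (map d xs))"
    by (simp add: sorted_wrt_rev sorted_wrt_map)
  have "proots (charpoly M) = (\<Sum>i\<in>UNIV. proots [:- d i, 1:])"
    unfolding M_def charpoly_spectral[OF P] by (rule proots_prod) simp
  also have "\<dots> = (\<Sum>i\<in>set xs. {#d i#})"
    by (simp add: xs)
  also have "\<dots> = mset (map d xs)"
    using xs(2) by (induction xs) auto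
  finally have "rev (sorted_list_of_multiset (proots (charpoly M))) = map d xs"
    using properties_for_sort[of "rev (map d xs)" "map d xs"] desc
    by (simp add: rev_swap del: mset_map)
  then have eigval: "eigval M j = d (xs ! (j - 1))" if "j \<in> {1..CARD('p)}" for j
    using that len unfolding eigval_def by (subst nth_map[symmetric]) auto
  show ?thesis
  proof
    show "bij_betw (\<lambda>j. xs ! (j - 1)) {1..CARD('p)} (UNIV :: 'p set)"
    proof (rule bij_betw_trans[of "\<lambda>j. j - 1" _ "{..<length xs}" "\<lambda>j. xs ! j", unfolded o_def])
      show "bij_betw (\<lambda>j. j - 1) {1..CARD('p)} {..<length xs}"
        by (rule bij_betw_byWitness[where f' = Suc]) (auto simp: len)
      show "bij_betw ((!) xs) {..<length xs} UNIV"
        using xs bij_betw_nth by blast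
    qed
    show "eigval M j = d (xs ! (j - 1))" if "j \<in> {1..CARD('p)}" for j
      by (rule eigval[OF that])
    show "eigval M j \<le> eigval M i" if "1 \<le> i" "i \<le> j" "j \<le> CARD('p)" for i j
    proof (cases "i = j")
      case False
      then have "- d (xs ! (i - 1)) \<le> - d (xs ! (j - 1))"
        using sorted_nth_mono[OF \<open>sorted (map (\<lambda>i. - d i) xs)\<close>, of "i - 1" "j - 1"] that len
        by auto
      then show ?thesis
        using that by (simp add: eigval)
    qed simp
  qed
qed

section \<open>The extremal property of the largest eigenvalues\<close>

text \<open>The weights \<open>w\<close> and the indicator function of \<open>T\<close> have the same sum, so \<open>d\<close> may be shifted by
  a constant \<open>c\<close>. If \<open>c\<close> separates the values of \<open>d\<close> on \<open>T\<close> from those off \<open>T\<close>, and \<open>0 \<le> w \<le> 1\<close>,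
  then every term on the right is nonnegative. The next two lemmas draw the inequality and its
  equality case from this.\<close>

lemma weighted_sum_gap:
  fixes d w :: "'i::finite \<Rightarrow> real"
  assumes "(\<Sum>i\<in>UNIV. w i) = card T"
  shows "(\<Sum>i\<in>T. d i) - (\<Sum>i\<in>UNIV. d i * w i)
       = (\<Sum>i\<in>UNIV. (d i - c) * ((if i \<in> T then 1 else 0) - w i))"
proof -
  have "(d i - c) * ((if i \<in> T then 1 else 0) - w i)
      = (if i \<in> T then d i else 0) - (if i \<in> T then c else 0) - d i * w i + c * w i" for i
    by (simp add: algebra_simps)
  then have "(\<Sum>i\<in>UNIV. (d i - c) * ((if i \<in> T then 1 else 0) - w i))
      = (\<Sum>i\<in>UNIV. if i \<in> T then d i else 0) - (\<Sum>i\<in>UNIV. if i \<in> T then c else 0)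
        - (\<Sum>i\<in>UNIV. d i * w i) + c * (\<Sum>i\<in>UNIV. w i)"
    by (simp add: sum_subtractf sum.distrib sum_distrib_left)
  also have "\<dots> = (\<Sum>i\<in>T. d i) - (\<Sum>i\<in>UNIV. d i * w i)"
    using assms by (simp add: sum.If_cases)
  finally show ?thesis
    by simp
qed

lemma weighted_sum_le_top:
  fixes d w :: "'i::finite \<Rightarrow> real"
  assumes w: "\<And>i. 0 \<le> w i" "\<And>i. w i \<le> 1" and total: "(\<Sum>i\<in>UNIV. w i) = card T"
    and T: "\<And>i. i \<in> T \<Longrightarrow> c \<le> d i" "\<And>i. i \<notin> T \<Longrightarrow> d i \<le> c"
  shows "(\<Sum>i\<in>UNIV. d i * w i) \<le> (\<Sum>i\<in>T. d i)"
proof -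
  have "0 \<le> (\<Sum>i\<in>UNIV. (d i - c) * ((if i \<in> T then 1 else 0) - w i))"
    using w T by (intro sum_nonneg) (auto simp: mult_nonpos_nonneg)
  then show ?thesis
    using weighted_sum_gap[OF total, of d c] by simp
qed

lemma weighted_sum_eq_top:
  fixes d w :: "'i::finite \<Rightarrow> real"
  assumes w: "\<And>i. 0 \<le> w i" "\<And>i. w i \<le> 1" and total: "(\<Sum>i\<in>UNIV. w i) = card T"
    and T: "\<And>i. i \<in> T \<Longrightarrow> c < d i" "\<And>i. i \<notin> T \<Longrightarrow> d i < c"
    and max: "(\<Sum>i\<in>T. d i) \<le> (\<Sum>i\<in>UNIV. d i * w i)"
    and i: "i \<notin> T"
  shows "w i = 0"
proof -
  let ?g = "\<lambda>i. (d i - c) * ((if i \<in> T then 1 else 0) - w i)"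
  have nonneg: "0 \<le> ?g i" for i
    using w[of i] T[of i] by (cases "i \<in> T") (auto simp: mult_le_0_iff)
  have "(\<Sum>i\<in>UNIV. ?g i) \<le> 0"
    using weighted_sum_gap[OF total, of d c] max by simp
  then have "(\<Sum>i\<in>UNIV. ?g i) = 0"
    by (intro antisym sum_nonneg nonneg)
  then have "?g i = 0"
    using nonneg by (subst (asm) sum_nonneg_eq_0_iff) auto
  then show ?thesis
    using T(2)[OF i] i by simp
qed

lemma trace_transpose_mult_self: "trace (transpose W ** W) = (\<Sum>i\<in>UNIV. W $ i \<bullet> W $ i)"
  for W :: "real^'q^'p"
  unfolding trace_def matrix_matrix_mult_def transpose_def inner_vec_def
  by simp (rule sum.swap)

lemma trace_spectral:
  fixes P :: "real^'p^'p" and Z :: "real^'q^'p"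
  defines "W \<equiv> transpose P ** Z"
  shows "trace (transpose Z ** (P ** diag_matrix d ** transpose P) ** Z)
       = (\<Sum>i\<in>UNIV. d i * (W $ i \<bullet> W $ i))"
proof -
  have "transpose Z ** (P ** diag_matrix d ** transpose P) ** Z
      = transpose W ** (diag_matrix d ** W)"
    by (simp add: W_def matrix_transpose_mul matrix_mul_assoc)
  also have "trace \<dots> = (\<Sum>j\<in>UNIV. \<Sum>i\<in>UNIV. d i * (W $ i $ j * W $ i $ j))"
    by (simp add: trace_def matrix_matrix_mult_def transpose_def if_distrib[of "\<lambda>x. x * _"]
        mult.left_commute cong: if_cong)
  also have "\<dots> = (\<Sum>i\<in>UNIV. d i * (W $ i \<bullet> W $ i))"
    by (subst sum.swap) (simp add: inner_vec_def sum_distrib_left)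
  finally show ?thesis .
qed

lemma trace_top_eigvecs:
  fixes Y :: "real^'q^'p"
  assumes "top_eigvecs M Y"
  shows "trace (transpose Y ** M ** Y) = (\<Sum>j=1..CARD('q). eigval M j)"
proof -
  obtain \<sigma> where Y: "Y \<in> stiefel" and \<sigma>: "bij_betw \<sigma> (UNIV :: 'q set) {1..CARD('q)}"
    and eig: "\<And>j. M *v column j Y = eigval M (\<sigma> j) *s column j Y"
    using assms by (auto simp: top_eigvecs_def)
  have "trace (transpose Y ** M ** Y) = (\<Sum>j\<in>UNIV. eigval M (\<sigma> j))"
    using Y by (simp add: trace_quadratic_columns eig scalar_mult_eq_scaleR
        stiefel_iff_orthonormal_columns)
  also have "\<dots> = (\<Sum>j=1..CARD('q). eigval M j)"
    using \<sigma> by (rule sum.reindex_bij_betw)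
  finally show ?thesis .
qed

lemma sum_row_weights:
  fixes W :: "real^'q^'p"
  assumes "W \<in> stiefel"
  shows "(\<Sum>i\<in>UNIV. W $ i \<bullet> W $ i) = CARD('q)"
  using assms by (simp add: trace_transpose_mult_self[symmetric] stiefel_def trace_I)

text \<open>In the eigenbasis, \<open>trace (Z\<^sup>T M Z)\<close> is the sum of the eigenvalues of \<open>M\<close> weighted by the squared
  norms of the rows of \<open>P\<^sup>T Z\<close>. These weights lie in \<open>[0, 1]\<close> and add up to the number of columns of
  \<open>Z\<close>, so the best they can do is to select the largest eigenvalues.\<close>

theorem ky_fan_inequality:
  fixes M :: "real^'p^'p" and Z :: "real^'q^'p"
  assumes sym: "symmetric_matrix M" and Z: "Z \<in> stiefel" and le: "CARD('q) \<le> CARD('p)"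
  shows "trace (transpose Z ** M ** Z) \<le> (\<Sum>j=1..CARD('q). eigval M j)"
proof -
  let ?k = "CARD('q)"
  obtain P d where P: "orthogonal_matrix P" and M: "M = P ** diag_matrix d ** transpose P"
    using spectral_decomposition[OF sym] .
  obtain \<pi> where \<pi>: "bij_betw \<pi> {1..CARD('p)} (UNIV :: 'p set)"
    and eig: "\<And>j. j \<in> {1..CARD('p)} \<Longrightarrow> eigval M j = d (\<pi> j)"
    and desc: "\<And>i j. 1 \<le> i \<Longrightarrow> i \<le> j \<Longrightarrow> j \<le> CARD('p) \<Longrightarrow> eigval M j \<le> eigval M i"
    using eigval_enumeration[OF P, of d] unfolding M[symmetric] by metis
  define T where "T = \<pi> ` {1..?k}"
  define W where "W = transpose P ** Z"
  have W: "W \<in> stiefel"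
    unfolding W_def using P Z by (simp add: stiefel_mult stiefel_square_iff)
  have inj: "inj_on \<pi> {1..?k}"
    using \<pi> le by (auto simp: bij_betw_def intro: inj_on_subset)
  have "trace (transpose Z ** M ** Z) = (\<Sum>i\<in>UNIV. d i * (W $ i \<bullet> W $ i))"
    unfolding M W_def by (rule trace_spectral)
  also have "\<dots> \<le> (\<Sum>i\<in>T. d i)"
  proof (rule weighted_sum_le_top[where c = "eigval M ?k"])
    show "(\<Sum>i\<in>UNIV. W $ i \<bullet> W $ i) = card T"
      using sum_row_weights[OF W] inj by (simp add: T_def card_image)
    show "eigval M ?k \<le> d i" if "i \<in> T" for i
      using that le desc[of _ ?k] eig by (auto simp: T_def)
    show "d i \<le> eigval M ?k" if "i \<notin> T" for i
    proof -
      obtain j where "j \<in> {1..CARD('p)}" "i = \<pi> j"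
        using \<pi> by (metis UNIV_I bij_betw_imp_surj_on imageE)
      with that show ?thesis
        using desc[of ?k j] eig[of j] by (force simp: T_def)
    qed
  qed (simp_all add: bessel_row_stiefel[OF W])
  also have "\<dots> = (\<Sum>j=1..?k. eigval M j)"
    unfolding T_def sum.reindex[OF inj] using le eig by simp
  finally show ?thesis .
qed

text \<open>The equality case, when the eigenvalue gap makes the invariant subspace unique. The weights of
  the unselected eigenvectors must vanish, so the corresponding rows of \<open>P\<^sup>T Z\<close> are zero and
  \<open>Z = P (P\<^sup>T Z)\<close> only involves the selected eigenvectors, which form the columns of \<open>Y\<close>.\<close>

theorem ky_fan_equality:
  fixes M :: "real^'p^'p" and Z :: "real^'q^'p"
  assumes sym: "symmetric_matrix M" and Z: "Z \<in> stiefel" and less: "CARD('q) < CARD('p)"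
    and gap: "eigval M (CARD('q) + 1) < eigval M CARD('q)"
    and max: "\<And>Y :: real^'q^'p. Y \<in> stiefel \<Longrightarrow>
      trace (transpose Y ** M ** Y) \<le> trace (transpose Z ** M ** Z)"
  obtains Y Q where "top_eigvecs M Y" "orthogonal_matrix Q" "Z = Y ** Q"
proof -
  let ?k = "CARD('q)"
  obtain P d where P: "orthogonal_matrix P" and M: "M = P ** diag_matrix d ** transpose P"
    using spectral_decomposition[OF sym] .
  obtain \<pi> where \<pi>: "bij_betw \<pi> {1..CARD('p)} (UNIV :: 'p set)"
    and eig: "\<And>j. j \<in> {1..CARD('p)} \<Longrightarrow> eigval M j = d (\<pi> j)"
    and desc: "\<And>i j. 1 \<le> i \<Longrightarrow> i \<le> j \<Longrightarrow> j \<le> CARD('p) \<Longrightarrow> eigval M j \<le> eigval M i"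
    using eigval_enumeration[OF P, of d] unfolding M[symmetric] by metis
  define T where "T = \<pi> ` {1..?k}"
  define W where "W = transpose P ** Z"
  have W: "W \<in> stiefel"
    unfolding W_def using P Z by (simp add: stiefel_mult stiefel_square_iff)
  have inj: "inj_on \<pi> {1..?k}"
    using \<pi> less by (auto simp: bij_betw_def intro: inj_on_subset)
  obtain \<sigma> where \<sigma>: "bij_betw \<sigma> (UNIV :: 'q set) {1..?k}"
    using finite_same_card_bij[of "UNIV :: 'q set" "{1..?k}"] by auto
  define \<tau> where "\<tau> = \<pi> \<circ> \<sigma>"
  have \<tau>: "bij_betw \<tau> UNIV T"
    unfolding \<tau>_def T_def using \<sigma> inj by (auto intro: bij_betw_trans inj_on_imp_bij_betw)
  then have inj\<tau>: "\<tau> i = \<tau> j \<longleftrightarrow> i = j" for i j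
    by (auto simp: bij_betw_def inj_on_def)
  define Y :: "real^'q^'p" where "Y = (\<chi> i j. P $ i $ \<tau> j)"
  define Q where "Q = transpose Y ** Z"
  have colY: "column j Y = column (\<tau> j) P" for j
    by (simp add: Y_def column_def)
  have PP: "P ** transpose P = mat 1" "transpose P ** P = mat 1"
    using P by (simp_all add: orthogonal_matrix_def)
  have Y: "Y \<in> stiefel"
    using P by (simp add: stiefel_iff_orthonormal_columns colY inj\<tau> flip: stiefel_square_iff)
  have eigP: "M *v column i P = d i *s column i P" for i
  proof -
    have "M ** P = P ** diag_matrix d"
      unfolding M by (simp add: matrix_mul_assoc[symmetric] PP)
    then have "column i (M ** P) = column i (P ** diag_matrix d)"
      by simp
    then show ?thesis
      by (simp add: vec_eq_iff column_def matrix_matrix_mult_def matrix_vector_mult_def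
          if_distrib[of "\<lambda>x. _ * x"] mult.commute cong: if_cong)
  qed
  have top: "top_eigvecs M Y"
    unfolding top_eigvecs_def
  proof (intro conjI exI[of _ \<sigma>] allI)
    fix j
    have "\<sigma> j \<in> {1..?k}"
      using \<sigma> by (auto simp: bij_betw_def)
    then show "M *v column j Y = eigval M (\<sigma> j) *s column j Y"
      using less eig[of "\<sigma> j"] by (simp add: colY eigP \<tau>_def)
  qed (fact Y \<sigma>)+
  have zero: "W $ i = 0" if "i \<notin> T" for i
  proof -
    \<comment> \<open>The midpoint of the gap separates the selected eigenvalues strictly from the others.\<close>
    define c where "c = (eigval M (?k + 1) + eigval M ?k) / 2"
    have "W $ i \<bullet> W $ i = 0"
    proof (rule weighted_sum_eq_top[where c = c and T = T and d = d and w = "\<lambda>i. W $ i \<bullet> W $ i"])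
      show "(\<Sum>i\<in>UNIV. W $ i \<bullet> W $ i) = card T"
        using sum_row_weights[OF W] inj by (simp add: T_def card_image)
      show "c < d i" if "i \<in> T" for i
        using that less gap desc[of _ ?k] eig by (fastforce simp: T_def c_def)
      show "d i < c" if "i \<notin> T" for i
      proof -
        obtain j where j: "j \<in> {1..CARD('p)}" "i = \<pi> j"
          using \<pi> by (metis UNIV_I bij_betw_imp_surj_on imageE)
        with that have "\<not> j \<le> ?k"
          by (auto simp: T_def)
        with j show ?thesis
          using desc[of "?k + 1" j] eig[of j] gap by (simp add: c_def)
      qed
      show "(\<Sum>i\<in>T. d i) \<le> (\<Sum>i\<in>UNIV. d i * (W $ i \<bullet> W $ i))"
        using max[OF Y] trace_top_eigvecs[OF top] less eig trace_spectral[of Z P d]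
        unfolding T_def sum.reindex[OF inj] by (simp add: W_def M[symmetric])
    qed (use that in \<open>simp_all add: bessel_row_stiefel[OF W]\<close>)
    then show ?thesis
      by simp
  qed
  have ZYQ: "Z = Y ** Q"
  proof -
    have "Z = P ** W"
      by (simp add: W_def matrix_mul_assoc PP)
    moreover have "(P ** W) $ a $ b = (Y ** Q) $ a $ b" for a b
    proof -
      have "(P ** W) $ a $ b = (\<Sum>i\<in>UNIV. P $ a $ i * W $ i $ b)"
        by (simp add: matrix_matrix_mult_def)
      also have "\<dots> = (\<Sum>i\<in>T. P $ a $ i * W $ i $ b)"
        by (rule sum.mono_neutral_right) (auto simp: zero)
      also have "\<dots> = (\<Sum>j\<in>UNIV. P $ a $ \<tau> j * W $ \<tau> j $ b)"
        by (rule sum.reindex_bij_betw[OF \<tau>, symmetric])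
      also have "\<dots> = (Y ** Q) $ a $ b"
        by (simp add: matrix_matrix_mult_def Q_def Y_def W_def transpose_def)
      finally show ?thesis .
    qed
    ultimately show ?thesis
      by (simp add: vec_eq_iff)
  qed
  have "orthogonal_matrix Q"
  proof -
    have "transpose Q ** Q = transpose Q ** (transpose Y ** Y) ** Q"
      using Y by (simp add: stiefel_def)
    also have "\<dots> = transpose Z ** Z"
      unfolding ZYQ by (simp add: matrix_transpose_mul matrix_mul_assoc)
    finally show ?thesis
      using Z by (simp add: stiefel_def orthogonal_matrix)
  qed
  with top ZYQ show ?thesis
    using that by blast
qed

lemma span_columns_mult_le: "span (columns (Y ** Q)) \<subseteq> span (columns Y)"
  for Y :: "real^'q^'p"
proof (rule span_minimal)
  show "columns (Y ** Q) \<subseteq> span (columns Y)"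
  proof
    fix x assume "x \<in> columns (Y ** Q)"
    then obtain j where "x = Y *v column j Q"
      by (auto simp: columns_image_basis matrix_vector_mul_assoc[symmetric]
          matrix_vector_mult_basis)
    then show "x \<in> span (columns Y)"
      by (simp add: matrix_vector_mult_in_columnspace)
  qed
qed simp

lemma top_invariant_basis_rotate:
  fixes Y :: "real^'q^'p"
  assumes Y: "top_eigvecs M Y" and Q: "orthogonal_matrix Q"
  shows "top_invariant_basis M (Y ** Q)"
proof -
  have "Y = (Y ** Q) ** transpose Q"
    using Q by (simp add: matrix_mul_assoc[symmetric] orthogonal_matrix_def)
  then have "span (columns (Y ** Q)) = span (columns Y)"
    by (metis span_columns_mult_le subset_antisym)
  moreover have "Y ** Q \<in> stiefel"
    using Y Q by (simp add: top_eigvecs_def stiefel_mult stiefel_square_iff)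
  ultimately show ?thesis
    using Y by (auto simp: top_invariant_basis_def)
qed

lemma top_eigvecs_rotate_invariant:
  fixes Y :: "real^'q^'p"
  assumes Y: "top_eigvecs M Y" and Q: "orthogonal_matrix Q"
  obtains L where "symmetric_matrix L" "M ** (Y ** Q) = (Y ** Q) ** L"
proof -
  obtain \<sigma> :: "'q \<Rightarrow> nat" where eig: "\<And>j. M *v column j Y = eigval M (\<sigma> j) *s column j Y"
    using Y by (auto simp: top_eigvecs_def)
  define \<Delta> where "\<Delta> = diag_matrix (\<lambda>j. eigval M (\<sigma> j))"
  have "(M ** Y) $ i $ j = (Y ** \<Delta>) $ i $ j" for i j
    using arg_cong[OF eig[of j], of "\<lambda>v. v $ i"]
    by (simp add: \<Delta>_def column_def matrix_matrix_mult_def matrix_vector_mult_def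
        if_distrib[of "\<lambda>x. _ * x"] mult.commute cong: if_cong)
  then have MY: "M ** Y = Y ** \<Delta>"
    by (simp add: vec_eq_iff)
  show ?thesis
  proof
    show "symmetric_matrix (transpose Q ** \<Delta> ** Q)"
      by (simp add: symmetric_matrix_def matrix_transpose_mul matrix_mul_assoc \<Delta>_def)
    have "(Y ** Q) ** (transpose Q ** \<Delta> ** Q) = Y ** (Q ** transpose Q) ** \<Delta> ** Q"
      by (simp add: matrix_mul_assoc)
    also have "\<dots> = M ** (Y ** Q)"
      using Q by (simp add: orthogonal_matrix_def MY[symmetric] matrix_mul_assoc)
    finally show "M ** (Y ** Q) = (Y ** Q) ** (transpose Q ** \<Delta> ** Q)" ..
  qed
qed

section \<open>One step of the iteration does not decrease the objective\<close>

text \<open>If the denominator vanished, \<open>B X\<close> would be zero, so the ranges of \<open>B\<close> and \<open>X\<close> would be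
  orthogonal subspaces whose dimensions add up to more than that of the whole space.\<close>

lemma denom_pos:
  fixes B :: "real^'p^'p" and X :: "real^'q^'p"
  assumes B: "pos_semidef B" and rank: "rank B > CARD('p) - CARD('q)" and X: "X \<in> stiefel"
  shows "0 < denom B X"
proof (rule ccontr)
  assume "\<not> 0 < denom B X"
  have sym: "symmetric_matrix B" and nonneg: "\<And>x. 0 \<le> x \<bullet> (B *v x)"
    using B by (auto simp: pos_semidef_def)
  have "(\<Sum>j\<in>UNIV. column j X \<bullet> (B *v column j X)) \<le> 0"
    using \<open>\<not> 0 < denom B X\<close> by (simp add: denom_def trace_quadratic_columns)
  then have "(\<Sum>j\<in>UNIV. column j X \<bullet> (B *v column j X)) = 0"
    by (intro antisym sum_nonneg nonneg)
  then have "column j X \<bullet> (B *v column j X) = 0" for j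
    by (subst (asm) sum_nonneg_eq_0_iff) (auto simp: nonneg)
  then have "(B *v column j X) \<bullet> (B *v column j X) = 0" for j
    using nonneg_form_null_vector[OF sym subspace_UNIV nonneg, of "column j X"] by blast
  then have "B *v column j X = 0" for j
    by simp
  then have BX: "B ** X = 0"
    by (simp add: vec_eq_iff matrix_matrix_mult_def matrix_vector_mult_def column_def)
  have "(B *v x) \<bullet> (X *v y) = 0" for x y
    using BX by (simp add: symmetric_inner[OF sym] matrix_vector_mul_assoc)
  then have "dim (range ((*v) B) \<union> range ((*v) X)) = rank B + rank X"
    unfolding rank_dim_range by (intro dim_orthogonal_sum) auto
  moreover have "dim (range ((*v) B) \<union> range ((*v) X)) \<le> CARD('p)"
    by (rule dim_subset_UNIV_cart)
  moreover have "rank X = CARD('q)"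
    unfolding full_rank_injective
  proof (rule injI)
    fix x y assume "X *v x = X *v y"
    then have "(x - y) \<bullet> (x - y) = 0"
      using stiefel_preserves_inner[OF X, of "x - y" "x - y"]
      by (simp add: matrix_vector_mult_diff_distrib)
    then show "x = y"
      by simp
  qed
  ultimately show False
    using rank by linarith
qed

lemma trace_scaleR: "trace (c *\<^sub>R M) = c * trace M" for M :: "real^'p^'p"
  by (simp add: trace_def sum_distrib_left)

lemma numer_eq: "numer A D X = trace (transpose X ** A ** X) + trace (transpose X ** D)"
  by (simp add: numer_def trace_add)

lemma trace_E_mat:
  fixes A B :: "real^'p^'p" and D X Y :: "real^'q^'p"
  shows "trace (transpose Y ** E_mat A B D \<theta> X ** Y)
    = 2 / (denom B X powr \<theta>) * (trace (transpose Y ** A ** Y)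
        + trace (transpose Y ** D ** (transpose X ** Y)) - \<theta> * f_one A B D X * denom B Y)"
proof -
  have "trace (transpose Y ** (X ** transpose D) ** Y)
      = trace (transpose (transpose Y ** (X ** transpose D) ** Y))"
    by (simp only: trace_transpose)
  also have "\<dots> = trace (transpose Y ** (D ** transpose X) ** Y)"
    by (simp add: matrix_transpose_mul matrix_mul_assoc)
  finally have "trace (transpose Y ** (X ** transpose D) ** Y)
      = trace (transpose Y ** D ** (transpose X ** Y))"
    by (simp add: matrix_mul_assoc)
  then show ?thesis
    by (simp add: E_mat_def denom_def matrix_scalar_ac scalar_matrix_assoc[symmetric]
        matrix_add_ldistrib matrix_add_rdistrib matrix_diff_ldistrib matrix_diff_rdistrib
        trace_scaleR trace_add trace_sub matrix_mul_assoc add_divide_distrib diff_divide_distrib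
        right_diff_distrib distrib_left mult_ac)
qed

lemma symmetric_E_mat:
  assumes "symmetric_matrix A" "symmetric_matrix B"
  shows "symmetric_matrix (E_mat A B D \<theta> X)"
proof -
  have "transpose (D ** transpose X + X ** transpose D) = D ** transpose X + X ** transpose D"
    by (simp add: vec_eq_iff transpose_def matrix_matrix_mult_def mult.commute add.commute)
  then show ?thesis
    using assms by (simp add: symmetric_matrix_def E_mat_def vec_eq_iff transpose_def)
qed

lemma trace_congruence_orthogonal:
  fixes Y :: "real^'q^'p"
  assumes Q: "orthogonal_matrix Q"
  shows "trace (transpose (Y ** Q) ** M ** (Y ** Q)) = trace (transpose Y ** M ** Y)"
proof -
  have "trace (transpose (Y ** Q) ** M ** (Y ** Q))
      = trace (transpose Q ** (transpose Y ** M ** Y ** Q))"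
    by (simp add: matrix_transpose_mul matrix_mul_assoc)
  also have "\<dots> = trace (transpose Y ** M ** Y ** (Q ** transpose Q))"
    by (subst trace_mul_sym) (simp add: matrix_mul_assoc)
  finally show ?thesis
    using Q by (simp add: orthogonal_matrix_def)
qed

text \<open>\<open>U V\<^sup>T\<close> is the orthogonal polar factor of \<open>Y\<^sup>T D\<close>: aligning \<open>Y\<close> by it turns \<open>Y\<^sup>T D\<close> into its
  symmetric positive semidefinite polar factor.\<close>

lemma polar_factor_svd:
  fixes D Y :: "real^'q^'p"
  assumes svd: "is_svd (transpose Y ** D) U S V"
  shows "transpose (Y ** U ** transpose V) ** D = V ** S ** transpose V"
proof -
  have "transpose (Y ** U ** transpose V) ** D = V ** transpose U ** (transpose Y ** D)"
    by (simp add: matrix_transpose_mul matrix_mul_assoc)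
  also have "\<dots> = V ** (transpose U ** U) ** S ** transpose V"
    using svd by (simp add: is_svd_def matrix_mul_assoc)
  finally show ?thesis
    using svd by (simp add: is_svd_def orthogonal_matrix_def)
qed

lemma pos_semidef_polar:
  fixes D Y :: "real^'q^'p"
  assumes svd: "is_svd (transpose Y ** D) U S V"
  shows "pos_semidef (transpose (Y ** U ** transpose V) ** D)"
proof -
  have "S = diag_matrix (\<lambda>i. S $ i $ i)" and nonneg: "\<And>i. 0 \<le> S $ i $ i"
    using svd by (auto simp: is_svd_def vec_eq_iff)
  then obtain s where S: "S = diag_matrix s"
    by blast
  have "x \<bullet> (V ** S ** transpose V *v x) = (\<Sum>i\<in>UNIV. S $ i $ i * ((transpose V *v x) $ i)^2)" for x
  proof -
    have "x \<bullet> (V ** S ** transpose V *v x) = x \<bullet> (V *v (S *v (transpose V *v x)))"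
      by (simp only: matrix_vector_mul_assoc matrix_mul_assoc)
    also have "\<dots> = (transpose V *v x) \<bullet> (S *v (transpose V *v x))"
      by (simp only: inner_matrix_vector transpose_transpose)
    also have "\<dots> = (\<Sum>i\<in>UNIV. S $ i $ i * ((transpose V *v x) $ i)^2)"
      unfolding S
      by (simp add: inner_vec_def matrix_vector_mult_def[of "diag_matrix s"] power2_eq_square
          if_distrib[of "\<lambda>x. _ * x"] mult_ac cong: if_cong)
    finally show ?thesis .
  qed
  then show ?thesis
    unfolding pos_semidef_def polar_factor_svd[OF svd] symmetric_matrix_def
    using nonneg by (auto simp: S matrix_transpose_mul matrix_mul_assoc intro!: sum_nonneg)
qed

lemma transpose_mult_nth: "(transpose M ** N) $ i $ j = column i M \<bullet> column j N"
  for M :: "real^'q^'p"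
  by (simp add: matrix_matrix_mult_def transpose_def column_def inner_vec_def)

text \<open>Among all contractions \<open>G\<close>, \<open>trace (Y\<^sup>T D G)\<close> is largest at \<open>G = V U\<^sup>T\<close>, where it is the sum of the
  singular values. For \<open>G = X\<^sup>T Y\<close> the diagonal entries of \<open>V\<^sup>T G U\<close>, which weight the singular values
  in the trace, are inner products of unit vectors, hence at most 1.\<close>

lemma trace_svd_mult_stiefel_le:
  fixes D X Y :: "real^'q^'p"
  assumes svd: "is_svd (transpose Y ** D) U S V" and X: "X \<in> stiefel" and Y: "Y \<in> stiefel"
  shows "trace (transpose Y ** D ** (transpose X ** Y))
    \<le> trace (transpose (Y ** U ** transpose V) ** D)"
proof -
  have U: "U \<in> stiefel" and V: "V \<in> stiefel" and VV: "transpose V ** V = mat 1"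
    and off: "\<And>i j. i \<noteq> j \<Longrightarrow> S $ i $ j = 0" and nonneg: "\<And>i. 0 \<le> S $ i $ i"
    and eq: "transpose Y ** D = U ** S ** transpose V"
    using svd by (auto simp: is_svd_def stiefel_square_iff orthogonal_matrix_def)
  define G where "G = transpose (X ** V) ** (Y ** U)"
  have G: "G $ j $ j \<le> 1" for j
  proof -
    have "G $ j $ j = column j (X ** V) \<bullet> column j (Y ** U)"
      by (simp add: G_def transpose_mult_nth)
    also have "\<dots> \<le> norm (column j (X ** V)) * norm (column j (Y ** U))"
      by (rule norm_cauchy_schwarz)
    finally show ?thesis
      using X Y U V by (simp add: norm_column_stiefel stiefel_mult)
  qed
  have "trace (transpose Y ** D ** (transpose X ** Y)) = trace (U ** (S ** transpose V ** transpose X ** Y))"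
    by (simp add: eq matrix_mul_assoc)
  also have "\<dots> = trace (S ** G)"
    by (subst trace_mul_sym) (simp add: G_def matrix_transpose_mul matrix_mul_assoc)
  also have "\<dots> = (\<Sum>j\<in>UNIV. S $ j $ j * G $ j $ j)"
  proof -
    have "(S ** G) $ j $ j = S $ j $ j * G $ j $ j" for j
    proof -
      have "(S ** G) $ j $ j = (\<Sum>i\<in>UNIV. S $ j $ i * G $ i $ j)"
        by (simp add: matrix_matrix_mult_def)
      also have "\<dots> = (\<Sum>i\<in>{j}. S $ j $ i * G $ i $ j)"
        by (rule sum.mono_neutral_right) (auto simp: off)
      finally show ?thesis
        by simp
    qed
    then show ?thesis
      by (simp add: trace_def)
  qed
  also have "\<dots> \<le> trace S"
    unfolding trace_def by (intro sum_mono) (simp add: mult_left_le G nonneg)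
  also have "trace S = trace (V ** (S ** transpose V))"
    by (subst trace_mul_sym) (simp add: matrix_mul_assoc[symmetric] VV)
  finally show ?thesis
    by (simp add: polar_factor_svd[OF svd] matrix_mul_assoc)
qed

text \<open>The graph of the concave function \<open>t \<mapsto> t powr \<theta>\<close> lies below its tangent at 1.\<close>

lemma bernoulli_powr:
  fixes t \<theta> :: real
  assumes "0 < t" "0 \<le> \<theta>" "\<theta> \<le> 1"
  shows "t powr \<theta> \<le> 1 + \<theta> * (t - 1)"
  using Youngs_inequality_0[of \<theta> "1 - \<theta>" t 1] assms by (simp add: algebra_simps)

text \<open>The gain in the surrogate \<open>Y \<mapsto> trace (Y\<^sup>T E(X) Y)\<close> bounds the gain in the objective. With
  \<open>a = denom B X\<close>, \<open>b = denom B Z\<close>, \<open>N = numer A D X\<close> and \<open>g\<close> the surrogate gain, the alignment step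
  gives \<open>numer A D Z \<ge> N (1 + \<theta> (b / a - 1)) + (a powr \<theta> / 2) g\<close>. The bracket dominates
  \<open>(b / a) powr \<theta>\<close>, with equality for \<open>\<theta> \<in> {0, 1}\<close>, which is why the sign of \<open>N\<close> only has to be
  controlled for \<open>0 < \<theta> < 1\<close>; dividing by \<open>b powr \<theta>\<close> gives the claim.\<close>

theorem scf_step_ascent:
  fixes A B :: "real^'p^'p" and D X Y :: "real^'q^'p"
  assumes X: "X \<in> stiefel" and Y: "Y \<in> stiefel"
    and svd: "is_svd (transpose Y ** D) U S V" and Z: "Z = Y ** U ** transpose V"
    and pos: "0 < denom B X" "0 < denom B Y"
    and \<theta>: "0 \<le> \<theta>" "\<theta> \<le> 1" and num: "0 < \<theta> \<and> \<theta> < 1 \<longrightarrow> 0 \<le> numer A D X"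
  shows "f_obj A B D \<theta> X + denom B X powr \<theta> / (2 * denom B Z powr \<theta>) *
      (trace (transpose Y ** E_mat A B D \<theta> X ** Y) - trace (transpose X ** E_mat A B D \<theta> X ** X))
    \<le> f_obj A B D \<theta> Z"
proof -
  define a b N where "a = denom B X" and "b = denom B Z" and "N = numer A D X"
  define g where "g = trace (transpose Y ** E_mat A B D \<theta> X ** Y)
    - trace (transpose X ** E_mat A B D \<theta> X ** X)"
  have "orthogonal_matrix (U ** transpose V)"
    using svd by (simp add: is_svd_def orthogonal_matrix_mul)
  then have rot: "trace (transpose Z ** M ** Z) = trace (transpose Y ** M ** Y)" for M
    using trace_congruence_orthogonal[of "U ** transpose V" Y M] by (simp add: Z matrix_mul_assoc)
  have b: "b = denom B Y"
    by (simp add: b_def denom_def rot)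
  have ab: "0 < a" "0 < b"
    using pos by (simp_all add: a_def b)
  have "a powr \<theta> / 2 * g = trace (transpose Y ** A ** Y)
        + trace (transpose Y ** D ** (transpose X ** Y)) - \<theta> * (N / a) * b
        - (N - \<theta> * (N / a) * a)"
  proof -
    have "trace (transpose X ** D ** (transpose X ** X)) = trace (transpose X ** D)"
      using X by (simp add: stiefel_def)
    then show ?thesis
      using ab unfolding g_def trace_E_mat f_one_def b
      by (simp add: a_def[symmetric] N_def[symmetric] numer_eq[of A D X, folded N_def] field_simps)
  qed
  also have "\<dots> \<le> numer A D Z - \<theta> * (N / a) * b - (N - \<theta> * (N / a) * a)"
    using trace_svd_mult_stiefel_le[OF svd X Y] unfolding numer_eq[of A D Z] rot by (simp add: Z)
  finally have "N * (1 + \<theta> * (b / a - 1)) + a powr \<theta> / 2 * g \<le> numer A D Z"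
    using ab by (simp add: field_simps)
  moreover have "N * (b / a) powr \<theta> \<le> N * (1 + \<theta> * (b / a - 1))"
  proof (cases "0 < \<theta> \<and> \<theta> < 1")
    case True
    then show ?thesis
      using num bernoulli_powr[of "b / a" \<theta>] ab \<theta> by (intro mult_left_mono) (auto simp: N_def)
  next
    case False
    then have "\<theta> = 0 \<or> \<theta> = 1"
      using \<theta> by linarith
    then show ?thesis
      using ab by auto
  qed
  ultimately have "N * (b / a) powr \<theta> + a powr \<theta> / 2 * g \<le> numer A D Z"
    by linarith
  then have "(N * (b / a) powr \<theta> + a powr \<theta> / 2 * g) / b powr \<theta> \<le> numer A D Z / b powr \<theta>"
    by (intro divide_right_mono) auto
  moreover have "(N * (b / a) powr \<theta> + a powr \<theta> / 2 * g) / b powr \<theta>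
      = N / a powr \<theta> + a powr \<theta> / (2 * b powr \<theta>) * g"
    using ab by (simp add: powr_divide add_divide_distrib)
  ultimately show ?thesis
    by (simp add: f_obj_def a_def b_def N_def g_def)
qed

section \<open>Continuity\<close>

lemma tendsto_matrix_mult [tendsto_intros]:
  fixes F :: "'i filter" and f :: "'i \<Rightarrow> real^'q^'p" and g :: "'i \<Rightarrow> real^'r^'q"
  assumes "(f \<longlongrightarrow> M) F" "(g \<longlongrightarrow> N) F"
  shows "((\<lambda>x. f x ** g x) \<longlongrightarrow> M ** N) F"
  unfolding matrix_matrix_mult_def
  by (intro tendsto_vec_lambda tendsto_sum tendsto_mult tendsto_vec_nth assms)

lemma tendsto_transpose [tendsto_intros]:
  fixes f :: "'i \<Rightarrow> real^'q^'p"
  assumes "(f \<longlongrightarrow> M) F"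
  shows "((\<lambda>x. transpose (f x)) \<longlongrightarrow> transpose M) F"
  unfolding transpose_def by (intro tendsto_vec_lambda tendsto_vec_nth assms)

lemma tendsto_trace [tendsto_intros]:
  fixes f :: "'i \<Rightarrow> real^'p^'p"
  assumes "(f \<longlongrightarrow> M) F"
  shows "((\<lambda>x. trace (f x)) \<longlongrightarrow> trace M) F"
  unfolding trace_def by (intro tendsto_sum tendsto_vec_nth assms)

lemma tendsto_denom [tendsto_intros]:
  assumes "(f \<longlongrightarrow> X) F"
  shows "((\<lambda>x. denom B (f x)) \<longlongrightarrow> denom B X) F"
  unfolding denom_def by (intro tendsto_intros assms)

lemma tendsto_numer [tendsto_intros]:
  assumes "(f \<longlongrightarrow> X) F"
  shows "((\<lambda>x. numer A D (f x)) \<longlongrightarrow> numer A D X) F"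
  unfolding numer_def by (intro tendsto_intros assms)

lemma tendsto_f_obj:
  assumes "(f \<longlongrightarrow> X) F" "0 < denom B X"
  shows "((\<lambda>x. f_obj A B D \<theta> (f x)) \<longlongrightarrow> f_obj A B D \<theta> X) F"
  unfolding f_obj_def using assms(2) by (intro tendsto_intros assms(1)) auto

lemma tendsto_E_mat:
  assumes "(f \<longlongrightarrow> X) F" "0 < denom B X"
  shows "((\<lambda>x. E_mat A B D \<theta> (f x)) \<longlongrightarrow> E_mat A B D \<theta> X) F"
  unfolding E_mat_def f_one_def using assms(2) by (intro tendsto_intros assms(1)) auto

lemma pos_semidef_limit:
  fixes M :: "nat \<Rightarrow> real^'p^'p"
  assumes lim: "M \<longlonglongrightarrow> L" and psd: "eventually (\<lambda>j. pos_semidef (M j)) sequentially"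
  shows "pos_semidef L"
proof -
  have "(\<lambda>j. transpose (M j)) \<longlonglongrightarrow> transpose L"
    by (intro tendsto_intros lim)
  moreover have "eventually (\<lambda>j. transpose (M j) = M j) sequentially"
    using psd by eventually_elim (simp add: pos_semidef_def symmetric_matrix_def)
  ultimately have "M \<longlonglongrightarrow> transpose L"
    by (rule Lim_transform_eventually)
  then have "transpose L = L"
    using lim LIMSEQ_unique by blast
  moreover have "0 \<le> x \<bullet> (L *v x)" for x
  proof (rule tendsto_lowerbound)
    show "(\<lambda>j. x \<bullet> (M j *v x)) \<longlonglongrightarrow> x \<bullet> (L *v x)"
      unfolding matrix_vector_mult_def
      by (intro tendsto_inner tendsto_const tendsto_vec_lambda tendsto_sum tendsto_mult
          tendsto_vec_nth lim)
    show "eventually (\<lambda>j. 0 \<le> x \<bullet> (M j *v x)) sequentially"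
      using psd by eventually_elim (simp add: pos_semidef_def)
  qed simp
  ultimately show ?thesis
    by (simp add: pos_semidef_def symmetric_matrix_def)
qed

section \<open>The first order condition\<close>

text \<open>\<open>E(X) X\<close> differs from the gradient expression by \<open>X\<close> times a multiple of \<open>D\<^sup>T X\<close>, which is
  symmetric together with \<open>X\<^sup>T D\<close>. So the eigenvalue equation for \<open>E(X)\<close> is the first order
  condition with a shifted multiplier.\<close>

lemma first_order_condition:
  fixes A B :: "real^'p^'p" and D X :: "real^'q^'p"
  assumes X: "X \<in> stiefel" and sym: "symmetric_matrix (transpose X ** D)"
    and L: "symmetric_matrix L" and inv: "E_mat A B D \<theta> X ** X = X ** L"
  shows "\<exists>\<Lambda>. symmetric_matrix \<Lambda> \<and> (2 / (denom B X powr \<theta>)) *\<^sub>R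
    (A ** X + (1 / 2) *\<^sub>R D - (\<theta> * f_one A B D X) *\<^sub>R (B ** X)) = X ** \<Lambda>"
proof (intro exI conjI)
  define c where "c = 2 / (denom B X powr \<theta>)"
  define \<Lambda> where "\<Lambda> = L - (c / 2) *\<^sub>R (transpose D ** X)"
  have DX: "transpose (transpose D ** X) = transpose D ** X"
    using sym by (simp add: symmetric_matrix_def matrix_transpose_mul)
  have "transpose \<Lambda> = transpose L - (c / 2) *\<^sub>R transpose (transpose D ** X)"
    by (simp add: \<Lambda>_def vec_eq_iff transpose_def)
  then show "symmetric_matrix \<Lambda>"
    using L DX by (simp add: \<Lambda>_def symmetric_matrix_def)
  have "X ** L = c *\<^sub>R (A ** X + (1 / 2) *\<^sub>R (D ** (transpose X ** X) + X ** (transpose D ** X))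
      - (\<theta> * f_one A B D X) *\<^sub>R (B ** X))"
    unfolding inv[symmetric] E_mat_def c_def
    by (simp add: scalar_matrix_assoc[symmetric] matrix_add_rdistrib matrix_diff_rdistrib
        matrix_mul_assoc)
  then have "X ** L = c *\<^sub>R (A ** X + (1 / 2) *\<^sub>R D - (\<theta> * f_one A B D X) *\<^sub>R (B ** X))
      + (c / 2) *\<^sub>R (X ** (transpose D ** X))"
    using X by (simp add: stiefel_def algebra_simps)
  then show "(2 / (denom B X powr \<theta>)) *\<^sub>R
      (A ** X + (1 / 2) *\<^sub>R D - (\<theta> * f_one A B D X) *\<^sub>R (B ** X)) = X ** \<Lambda>"
    by (simp add: \<Lambda>_def matrix_diff_ldistrib matrix_scalar_ac scalar_matrix_assoc[symmetric]
        c_def[symmetric])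
qed

section \<open>Convergence of the iteration\<close>

theorem theorem4p2:
  fixes A B :: "real^'n^'n" and D :: "real^'k^'n" and \<theta> :: real
    and X Xh :: "nat \<Rightarrow> real^'k^'n"
  assumes "CARD('k) < CARD('n)"
    and "symmetric_matrix A"
    and "pos_semidef B"
    and "rank B > CARD('n) - CARD('k)"
    and "0 \<le> \<theta>" and "\<theta> \<le> 1"
    and "\<exists>Y :: real^'k^'n. Y \<in> stiefel \<and> 0 \<le> numer A D Y"
    and "scf_iteration A B D \<theta> X Xh"
  shows
    "(incseq (\<lambda>i. f_obj A B D \<theta> (X i)) \<and> convergent (\<lambda>i. f_obj A B D \<theta> (X i)))
     \<and>
     (\<forall>i\<ge>1.
        trace (transpose (Xh i) ** E_mat A B D \<theta> (X (i - 1)) ** Xh i)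
          > trace (transpose (X (i - 1)) ** E_mat A B D \<theta> (X (i - 1)) ** X (i - 1))
        \<longrightarrow> f_obj A B D \<theta> (X (i - 1)) < f_obj A B D \<theta> (X i))
     \<and>
     ((\<exists>r :: nat \<Rightarrow> nat. strict_mono r \<and> convergent (X \<circ> r)) \<and>
      (\<forall>r :: nat \<Rightarrow> nat. strict_mono r \<and> convergent (X \<circ> r) \<longrightarrow>
         (\<lambda>j. f_obj A B D \<theta> (X (r j))) \<longlonglongrightarrow> lim (\<lambda>i. f_obj A B D \<theta> (X i))))
     \<and>
     (\<forall>(r :: nat \<Rightarrow> nat) Xs.
        strict_mono r \<and> (X \<circ> r) \<longlonglongrightarrow> Xs \<and>
        eigval (E_mat A B D \<theta> Xs) CARD('k) - eigval (E_mat A B D \<theta> Xs) (CARD('k) + 1) > 0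
        \<longrightarrow>
        Xs \<in> stiefel \<and>
        pos_semidef (transpose Xs ** D) \<and>
        ((\<exists>\<^sub>F j in sequentially. top_eigvecs (E_mat A B D \<theta> (X (r j))) (Xh (Suc (r j)))) \<longrightarrow>
           (\<exists>\<Lambda> :: real^'k^'k. symmetric_matrix \<Lambda> \<and>
              (2 / (denom B Xs powr \<theta>)) *\<^sub>R
                (A ** Xs + (1 / 2) *\<^sub>R D - (\<theta> * f_one A B D Xs) *\<^sub>R (B ** Xs)) = Xs ** \<Lambda>) \<and>
           top_invariant_basis (E_mat A B D \<theta> Xs) Xs))"
proof -
  have symA: "symmetric_matrix A" and psdB: "pos_semidef B" and \<theta>: "0 \<le> \<theta>" "\<theta> \<le> 1"
    and less: "CARD('k) < CARD('n)"
    using assms by auto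
  have symB: "symmetric_matrix B"
    using psdB by (simp add: pos_semidef_def)
  let ?f = "f_obj A B D \<theta>"
  let ?E = "E_mat A B D \<theta>"
  define q where "q M Y = trace (transpose Y ** M ** Y)" for M :: "real^'n^'n" and Y :: "real^'k^'n"
  have pos: "0 < denom B Y" if "Y \<in> stiefel" for Y :: "real^'k^'n"
    using denom_pos[OF psdB _ that] assms(4) by simp
  have symE: "symmetric_matrix (?E Y)" for Y
    using symA symB by (rule symmetric_E_mat)
  have X0: "X 0 \<in> stiefel" "0 < \<theta> \<and> \<theta> < 1 \<longrightarrow> 0 \<le> numer A D (X 0)"
    using assms(8) by (auto simp: scf_iteration_def)
  have step: "Xh (Suc i) \<in> stiefel
      \<and> (top_eigvecs (?E (X i)) (Xh (Suc i)) \<or> q (?E (X i)) (X i) < q (?E (X i)) (Xh (Suc i)))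
      \<and> (\<exists>U S V. is_svd (transpose (Xh (Suc i)) ** D) U S V \<and> X (Suc i) = Xh (Suc i) ** U ** transpose V)"
    for i
    using assms(8) unfolding scf_iteration_def q_def
    by (metis Suc_diff_1 le_add1 plus_1_eq_Suc zero_less_Suc diff_Suc_1)
  then have Xh: "Xh (Suc i) \<in> stiefel" for i
    by blast
  have top_max: "q (?E (X i)) W \<le> q (?E (X i)) (Xh (Suc i))"
    if "top_eigvecs (?E (X i)) (Xh (Suc i))" "W \<in> stiefel" for i W
    using ky_fan_inequality[OF symE that(2)] trace_top_eigvecs[OF that(1)] less by (simp add: q_def)
  \<comment> \<open>\<open>\<delta> i\<close> is the surrogate gain of a step and \<open>w i\<close> the factor with which it enters the objective.\<close>
  define w where "w i = denom B (X i) powr \<theta> / (2 * denom B (X (Suc i)) powr \<theta>)" for i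
  define \<delta> where "\<delta> i = q (?E (X i)) (Xh (Suc i)) - q (?E (X i)) (X i)" for i
  have invariant: "X i \<in> stiefel \<and> (0 < \<theta> \<and> \<theta> < 1 \<longrightarrow> 0 \<le> numer A D (X i))" (is "?I i")
    and ascent: "0 \<le> \<delta> i \<and> ?f (X i) + w i * \<delta> i \<le> ?f (X (Suc i))" (is "?A i") for i
  proof -
    have next_step: "?A i \<and> ?I (Suc i)" if "?I i" for i
    proof -
      obtain U S V where svd: "is_svd (transpose (Xh (Suc i)) ** D) U S V"
        and XS: "X (Suc i) = Xh (Suc i) ** U ** transpose V"
        using step by blast
      have "U \<in> stiefel" "transpose V \<in> stiefel"
        using svd by (simp_all add: is_svd_def stiefel_square_iff)
      then have stS: "X (Suc i) \<in> stiefel"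
        unfolding XS using Xh by (intro stiefel_mult)
      have "0 \<le> \<delta> i"
        using step[of i] top_max[of i "X i"] that by (auto simp: \<delta>_def)
      moreover have up: "?f (X i) + w i * \<delta> i \<le> ?f (X (Suc i))"
        unfolding w_def \<delta>_def q_def
        using that by (intro scf_step_ascent[OF _ Xh svd XS _ _ \<theta>] pos Xh) auto
      moreover have "0 \<le> numer A D (X (Suc i))" if "0 < \<theta> \<and> \<theta> < 1"
      proof -
        have "0 \<le> ?f (X i)"
          using \<open>?I i\<close> that by (simp add: f_obj_def)
        then have "0 \<le> ?f (X (Suc i))"
          using up \<open>0 \<le> \<delta> i\<close> by (smt (verit) mult_nonneg_nonneg w_def divide_nonneg_nonneg powr_ge_zero)
        then show ?thesis
          using pos[OF stS] by (simp add: f_obj_def zero_le_divide_iff)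
      qed
      ultimately show ?thesis
        using stS by blast
    qed
    have "?I i" for i
      by (induction i) (use X0 next_step in blast)+
    then show "?I i" "?A i"
      using next_step by blast+
  qed
  have st: "X i \<in> stiefel" for i
    using invariant by blast
  have w_pos: "0 < w i" for i
    using pos[OF st[of i]] pos[OF st[of "Suc i"]] by (simp add: w_def)
  have incr: "incseq (\<lambda>i. ?f (X i))"
    using ascent w_pos by (intro incseq_SucI) (smt (verit) mult_nonneg_nonneg)
  have strict: "?f (X (i - 1)) < ?f (X i)"
    if i1: "1 \<le> i" and gain: "q (?E (X (i - 1))) (X (i - 1)) < q (?E (X (i - 1))) (Xh i)" for i
  proof -
    obtain m where i: "i = Suc m"
      using i1 by (cases i) auto
    have "0 < w m * \<delta> m"
      using gain w_pos[of m] by (simp add: i \<delta>_def)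
    then show ?thesis
      using ascent[of m] by (simp add: i)
  qed
  have f_lim: "(\<lambda>j. ?f (X (r j))) \<longlonglongrightarrow> ?f Xs" if "(X \<circ> r) \<longlonglongrightarrow> Xs" "Xs \<in> stiefel" for r Xs
    using tendsto_f_obj[OF that(1) pos[OF that(2)]] by (simp add: o_def)
  have "\<forall>i. X i \<in> stiefel"
    using st by blast
  with compact_stiefel obtain X\<^sub>0 r0 where r0: "X\<^sub>0 \<in> stiefel" "strict_mono r0" "(X \<circ> r0) \<longlonglongrightarrow> X\<^sub>0"
    unfolding compact_eq_seq_compact_metric seq_compact_def by blast
  have conv: "convergent (\<lambda>i. ?f (X i))"
  proof -
    have "?f (X i) \<le> ?f X\<^sub>0" for i
    proof (rule LIMSEQ_le_const[OF f_lim[OF r0(3,1)]], intro exI allI impI)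
      fix j assume "i \<le> j"
      then show "?f (X i) \<le> ?f (X (r0 j))"
        using incr seq_suble[OF r0(2), of j] by (meson incseqD le_trans)
    qed
    then show ?thesis
      using incseq_convergent[OF incr] convergentI by metis
  qed
  have sub_lim: "(\<lambda>j. ?f (X (r j))) \<longlonglongrightarrow> lim (\<lambda>i. ?f (X i))" if "strict_mono r" for r
    using LIMSEQ_subseq_LIMSEQ[OF _ that] conv by (simp add: convergent_LIMSEQ_iff o_def)
  have limit_point: "Xs \<in> stiefel \<and> pos_semidef (transpose Xs ** D) \<and>
      ((\<exists>\<^sub>F j in sequentially. top_eigvecs (?E (X (r j))) (Xh (Suc (r j)))) \<longrightarrow>
         (\<exists>\<Lambda>. symmetric_matrix \<Lambda> \<and> (2 / (denom B Xs powr \<theta>)) *\<^sub>R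
            (A ** Xs + (1 / 2) *\<^sub>R D - (\<theta> * f_one A B D Xs) *\<^sub>R (B ** Xs)) = Xs ** \<Lambda>) \<and>
         top_invariant_basis (?E Xs) Xs)"
    if r: "strict_mono r" and lim: "(X \<circ> r) \<longlonglongrightarrow> Xs"
      and gap: "eigval (?E Xs) CARD('k) - eigval (?E Xs) (CARD('k) + 1) > 0" for r Xs
  proof -
    have Xs: "Xs \<in> stiefel"
      using closed_sequentially[OF compact_imp_closed[OF compact_stiefel] _ lim] st by simp
    have psd: "pos_semidef (transpose Xs ** D)"
    proof (rule pos_semidef_limit)
      show "(\<lambda>j. transpose ((X \<circ> r) j) ** D) \<longlonglongrightarrow> transpose Xs ** D"
        by (intro tendsto_intros lim)
      show "eventually (\<lambda>j. pos_semidef (transpose ((X \<circ> r) j) ** D)) sequentially"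
        using eventually_gt_at_top[of 0]
      proof eventually_elim
        case (elim j)
        then obtain m where m: "r j = Suc m"
          using seq_suble[OF r, of j] by (cases "r j") auto
        obtain U S V where "is_svd (transpose (Xh (Suc m)) ** D) U S V"
          "X (Suc m) = Xh (Suc m) ** U ** transpose V"
          using step by blast
        then show ?case
          using pos_semidef_polar m by fastforce
      qed
    qed
    moreover have "(\<exists>\<Lambda>. symmetric_matrix \<Lambda> \<and> (2 / (denom B Xs powr \<theta>)) *\<^sub>R
            (A ** Xs + (1 / 2) *\<^sub>R D - (\<theta> * f_one A B D Xs) *\<^sub>R (B ** Xs)) = Xs ** \<Lambda>) \<and>
         top_invariant_basis (?E Xs) Xs"
      if freq: "\<exists>\<^sub>F j in sequentially. top_eigvecs (?E (X (r j))) (Xh (Suc (r j)))"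
    proof -
      let ?J = "{j. top_eigvecs (?E (X (r j))) (Xh (Suc (r j)))}"
      have inf_J: "infinite ?J"
        using freq unfolding cofinite_eq_sequentially[symmetric] frequently_cofinite .
      \<comment> \<open>Refine the subsequence so that its steps use top eigenvectors and its successors converge
          too. The factors \<open>w\<close> then have a positive limit.\<close>
      obtain t0 :: "nat \<Rightarrow> nat" where "strict_mono t0 \<and> (\<forall>j. t0 j \<in> ?J)"
        using infinite_enumerate[OF inf_J] ..
      then have t0: "strict_mono t0" "\<And>j. top_eigvecs (?E (X (r (t0 j)))) (Xh (Suc (r (t0 j))))"
        by simp_all
      have "\<forall>j. X (Suc (r (t0 j))) \<in> stiefel"
        using st by blast
      then obtain Z t1 where Z: "Z \<in> stiefel" and t1: "strict_mono t1"
        and limZ: "((\<lambda>j. X (Suc (r (t0 j)))) \<circ> t1) \<longlonglongrightarrow> Z"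
        using compact_stiefel unfolding compact_eq_seq_compact_metric seq_compact_def by meson
      define s where "s = r \<circ> t0 \<circ> t1"
      have mono_s: "strict_mono s" and mono_Ss: "strict_mono (Suc \<circ> s)"
        using r t0(1) t1 by (auto simp: s_def strict_mono_def)
      have top: "top_eigvecs (?E (X (s j))) (Xh (Suc (s j)))" for j
        unfolding s_def o_def by (rule t0(2))
      have lim_s: "(\<lambda>j. X (s j)) \<longlonglongrightarrow> Xs"
        using LIMSEQ_subseq_LIMSEQ[OF lim, of "t0 \<circ> t1"] t0(1) t1
        by (simp add: s_def o_def strict_mono_def)
      have lim_Ss: "(\<lambda>j. X (Suc (s j))) \<longlonglongrightarrow> Z"
        using limZ by (simp add: s_def o_def)
      \<comment> \<open>The increments of the objective tend to 0, so the surrogate gain, which is the distance to the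
          maximal trace, does so as well. In the limit \<open>Xs\<close> attains the maximum.\<close>
      have maximal: "q (?E Xs) W \<le> q (?E Xs) Xs" if "W \<in> stiefel" for W
      proof -
        have le: "q (?E (X (s j))) W
            \<le> q (?E (X (s j))) (X (s j)) + (?f (X (Suc (s j))) - ?f (X (s j))) / w (s j)" for j
        proof -
          have "\<delta> (s j) \<le> (?f (X (Suc (s j))) - ?f (X (s j))) / w (s j)"
            using ascent[of "s j"] w_pos[of "s j"] by (simp add: pos_le_divide_eq mult.commute)
          then show ?thesis
            using top_max[OF top that, of j] by (simp add: \<delta>_def)
        qed
        have "(\<lambda>j. q (?E (X (s j))) W) \<longlonglongrightarrow> q (?E Xs) W"
          unfolding q_def by (intro tendsto_intros tendsto_E_mat lim_s pos Xs)
        moreover have "(\<lambda>j. q (?E (X (s j))) (X (s j))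
            + (?f (X (Suc (s j))) - ?f (X (s j))) / w (s j)) \<longlonglongrightarrow>
          q (?E Xs) Xs + (lim (\<lambda>i. ?f (X i)) - lim (\<lambda>i. ?f (X i)))
            / (denom B Xs powr \<theta> / (2 * denom B Z powr \<theta>))"
          unfolding q_def w_def
          using sub_lim[OF mono_Ss] pos[OF Xs] pos[OF Z]
          by (intro tendsto_intros tendsto_E_mat lim_s lim_Ss pos Xs Z sub_lim[OF mono_s])
             (auto simp: o_def)
        ultimately have "q (?E Xs) W \<le> q (?E Xs) Xs + (lim (\<lambda>i. ?f (X i)) - lim (\<lambda>i. ?f (X i)))
            / (denom B Xs powr \<theta> / (2 * denom B Z powr \<theta>))"
          by (rule LIMSEQ_le) (use le in blast)
        then show ?thesis
          by simp
      qed
      obtain Y Q where Y: "top_eigvecs (?E Xs) Y" and Q: "orthogonal_matrix Q" and XsYQ: "Xs = Y ** Q"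
        using ky_fan_equality[OF symE Xs less] gap maximal unfolding q_def by (metis diff_gt_0_iff_gt)
      obtain L where "symmetric_matrix L" "?E Xs ** Xs = Xs ** L"
        using top_eigvecs_rotate_invariant[OF Y Q] unfolding XsYQ[symmetric] by blast
      moreover have "symmetric_matrix (transpose Xs ** D)"
        using psd by (simp add: pos_semidef_def)
      moreover have "top_invariant_basis (?E Xs) Xs"
        using top_invariant_basis_rotate[OF Y Q] by (simp only: XsYQ[symmetric])
      ultimately show ?thesis
        using first_order_condition[OF Xs] by blast
    qed
    ultimately show ?thesis
      using Xs by blast
  qed
  show ?thesis
  proof (intro conjI)
    show "\<forall>i\<ge>1. trace (transpose (Xh i) ** ?E (X (i - 1)) ** Xh i)
        > trace (transpose (X (i - 1)) ** ?E (X (i - 1)) ** X (i - 1)) \<longrightarrow> ?f (X (i - 1)) < ?f (X i)"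
      using strict unfolding q_def by blast
    show "\<exists>r. strict_mono r \<and> convergent (X \<circ> r)"
      using r0 by (auto simp: convergent_def)
    show "\<forall>r. strict_mono r \<and> convergent (X \<circ> r) \<longrightarrow>
        (\<lambda>j. ?f (X (r j))) \<longlonglongrightarrow> lim (\<lambda>i. ?f (X i))"
      using sub_lim by blast
  qed (use incr conv limit_point in blast)+
qed

end
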